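(* With the matrices defined in the context, the following hold. (1) The matrices $N_i'$ are expressed as $$N_1'=4N_2-N_1+\Delta_{1,0}',\qquad N_2'=N_2,$$ where $\Delta_{1,0}'$ is a non-zero element of $\operatorname{End}(\mathbb{R}^6)$ which annihilates the subspace $W_2$, i.e. $\Delta_{1,0}'|_{W_2}=0$. (2) The cones $\Sigma_{o_2}=\mathbb{R}_{>0}N_1'+\mathbb{R}_{>0}N_2'$ and $\Sigma_{o_1}=\mathbb{R}_{>0}N_1+\mathbb{R}_{>0}N_2$ glue together along $N_2'=N_2$ (their closures share the boundary ray $\mathbb{R}_{\ge0}N_2'=\mathbb{R}_{\ge0}N_2$). They are not both contained in one two-dimensional plane of $\operatorname{End}(\mathbb{R}^6)$.
   Context: The space $H^3(X^*_{b_o},\mathbb{R})$ is identified with $\mathbb{R}^6$ (column vectors) through an ordered basis $\alpha_0,\alpha_1,\alpha_2,\beta_2,\beta_1,\beta_0$, endomorphisms with $6\times6$ matrices acting on column vectors, and $W_2=\langle\alpha_0,\alpha_1,\alpha_2\rangle$. $$\mathsf{T}_x=\begin{pmatrix}1&0&0&0&0&0\\1&1&0&0&0&0\\0&0&1&0&0&0\\5&10&10&1&0&0\\2&5&10&0&1&0\\-5&-3&-5&0&-1&1\end{pmatrix},\quad \mathsf{T}_y=\begin{pmatrix}1&0&0&0&0&0\\0&1&0&0&0&0\\1&0&1&0&0&0\\2&10&5&1&0&0\\5&10&10&0&1&0\\-5&-5&-3&-1&0&1\end{pmatrix},$$ $$\check\varphi_{21}=\begin{pmatrix}-1&0&0&0&0&0\\0&1&-4&2&25&0\\0&0&-1&0&-2&0\\0&0&0&-1&-4&0\\0&0&0&0&1&0\\0&0&0&0&0&-1\end{pmatrix}.$$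 Put $N_1=-{}^t(\log\mathsf{T}_x)$, $N_2=-{}^t(\log\mathsf{T}_y)$ (logarithms of unipotent matrices), and $N_i'=\check\varphi_{21}^{-1}N_i\check\varphi_{21}$ for $i=1,2$. *)

theory Defs
  imports "HOL-Analysis.Analysis"
begin

text \<open>
  The space \<open>H\<^sup>3\<close> is \<open>real ^ 6\<close>, with the ordered basis
  \<open>\<alpha>\<^sub>0, \<alpha>\<^sub>1, \<alpha>\<^sub>2, \<beta>\<^sub>2, \<beta>\<^sub>1, \<beta>\<^sub>0\<close> at the indices \<open>1, \<dots>, 6\<close> (in the index type \<open>6\<close>
  the numeral \<open>6\<close> equals \<open>0\<close>).  A matrix is listed row by row and acts on column vectors by
  \<open>*v\<close>; the product of matrices is \<open>**\<close>.
\<close>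

type_synonym mat6 = "real ^ 6 ^ 6"

definition Tx :: mat6 where
  "Tx = vector
    [vector [ 1,  0,  0, 0,  0, 0],
     vector [ 1,  1,  0, 0,  0, 0],
     vector [ 0,  0,  1, 0,  0, 0],
     vector [ 5, 10, 10, 1,  0, 0],
     vector [ 2,  5, 10, 0,  1, 0],
     vector [-5, -3, -5, 0, -1, 1]]"

definition Ty :: mat6 where
  "Ty = vector
    [vector [ 1,  0,  0,  0, 0, 0],
     vector [ 0,  1,  0,  0, 0, 0],
     vector [ 1,  0,  1,  0, 0, 0],
     vector [ 2, 10,  5,  1, 0, 0],
     vector [ 5, 10, 10,  0, 1, 0],
     vector [-5, -5, -3, -1, 0, 1]]"

definition phi21 :: mat6 where
  "phi21 = vector
    [vector [-1, 0,  0,  0,  0,  0],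
     vector [ 0, 1, -4,  2, 25,  0],
     vector [ 0, 0, -1,  0, -2,  0],
     vector [ 0, 0,  0, -1, -4,  0],
     vector [ 0, 0,  0,  0,  1,  0],
     vector [ 0, 0,  0,  0,  0, -1]]"

text \<open>The operation \<open>^\<close> on \<open>real ^ 'n ^ 'n\<close> would be the componentwise power.\<close>

primrec matpow :: "real ^ 'n ^ 'n \<Rightarrow> nat \<Rightarrow> real ^ 'n ^ 'n" where
  "matpow A 0 = mat 1"
| "matpow A (Suc k) = A ** matpow A k"

text \<open>
  The series \<open>log T = (T - 1) - (T - 1)\<^sup>2/2 + \<dots>\<close>.  For a unipotent matrix \<open>T\<close> of size \<open>n\<close> one has
  \<open>(T - 1)\<^sup>n = 0\<close>, so the series stops at the exponent \<open>n - 1\<close>; the definition is meant for such \<open>T\<close> only.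
\<close>

definition unipotent_log :: "real ^ 'n ^ 'n \<Rightarrow> real ^ 'n ^ 'n" where
  "unipotent_log T =
    (\<Sum>k = 1..<CARD('n). ((- 1) ^ (k + 1) / real k) *\<^sub>R matpow (T - mat 1) k)"

definition N1 :: mat6 where "N1 = - transpose (unipotent_log Tx)"

definition N2 :: mat6 where "N2 = - transpose (unipotent_log Ty)"

definition N1' :: mat6 where "N1' = matrix_inv phi21 ** N1 ** phi21"

definition N2' :: mat6 where "N2' = matrix_inv phi21 ** N2 ** phi21"

definition W2 :: "(real ^ 6) set" where
  "W2 = span {axis 1 1, axis 2 1, axis 3 1}"

definition open_cone :: "'a::real_vector \<Rightarrow> 'a \<Rightarrow> 'a set" where
  "open_cone X Y = {a *\<^sub>R X + b *\<^sub>R Y | a b. a > 0 \<and> b > 0}"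

definition closed_ray :: "'a::real_vector \<Rightarrow> 'a set" where
  "closed_ray X = {a *\<^sub>R X | a. a \<ge> 0}"

definition Sigma_o1 :: "mat6 set" where "Sigma_o1 = open_cone N1 N2"

definition Sigma_o2 :: "mat6 set" where "Sigma_o2 = open_cone N1' N2'"

end

theory Submission
  imports Defs
begin

text \<open>
  Part (1) is a finite computation.  Both \<open>Tx - 1\<close> and \<open>Ty - 1\<close> have vanishing fourth power, so each
  logarithm has three terms and \<open>N1\<close>, \<open>N2\<close> can be written down.  To conjugate, no inverse has to be
  multiplied out: \<open>matrix_inv phi21 ** N ** phi21 = M\<close> amounts to \<open>N ** phi21 = phi21 ** M\<close> once
  \<open>phi21\<close> is invertible.  For \<open>N2\<close> this says that \<open>N2\<close> commutes with \<open>phi21\<close>; for \<open>N1\<close> the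
  matrix \<open>M\<close> is \<open>4 N2 - N1\<close> plus a nonzero \<open>\<Delta>\<close> whose first three columns vanish.

  Part (2) rests on \<open>N2' = N2\<close> and on the linear independence of \<open>N1\<close>, \<open>N2\<close>, \<open>N1'\<close>.  The latter
  holds because \<open>N1\<close> and \<open>N2\<close> are already independent as maps on \<open>W2\<close>, where \<open>\<Delta>\<close> vanishes: a
  combination of the two that equals \<open>\<Delta>\<close> would have zero coefficients, against \<open>\<Delta> \<noteq> 0\<close>.  Hence
  \<open>N1' = 4 N2 - N1 + \<Delta>\<close> lies outside their span.

  The cone of two independent vectors is the image of the open quadrant of \<open>\<real>\<^sup>2\<close> under an injective
  linear map, and such maps commute with closure and relative interior.  Hence the closed cone consists
  of the combinations with nonnegative coefficients, and its boundary of those with a zero coefficient.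
  For independent \<open>X\<close>, \<open>Y\<close>, \<open>Z\<close>, comparing coefficients shows that the closed cones of \<open>X, Y\<close> and
  \<open>Z, Y\<close> meet exactly in the ray of \<open>Y\<close>.  An affine plane that contains both open cones is closed, so it
  contains their closures and in particular \<open>0, X, Y, Z\<close>, which span three dimensions.
\<close>

section \<open>Six by six matrices in coordinates\<close>

lemma exhaust_6: "x = 1 \<or> x = 2 \<or> x = 3 \<or> x = 4 \<or> x = 5 \<or> x = 6" for x :: 6
proof (induct x)
  case (of_int z)
  then have "z = 0 \<or> z = 1 \<or> z = 2 \<or> z = 3 \<or> z = 4 \<or> z = 5" by fastforce
  then show ?case by auto
qed

lemma forall_6: "(\<forall>i::6. P i) \<longleftrightarrow> P 1 \<and> P 2 \<and> P 3 \<and> P 4 \<and> P 5 \<and> P 6"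
  by (metis exhaust_6)

lemma UNIV_6: "UNIV = {1, 2, 3, 4, 5, 6::6}"
  using exhaust_6 by auto

lemma sum_6: "sum f (UNIV::6 set) = f 1 + f 2 + f 3 + f 4 + f 5 + f 6"
  unfolding UNIV_6 by (simp add: ac_simps)

lemma vector_6:
  "(vector [a, b, c, d, e, f] :: ('a::zero)^6) $ 1 = a"
  "(vector [a, b, c, d, e, f] :: ('a::zero)^6) $ 2 = b"
  "(vector [a, b, c, d, e, f] :: ('a::zero)^6) $ 3 = c"
  "(vector [a, b, c, d, e, f] :: ('a::zero)^6) $ 4 = d"
  "(vector [a, b, c, d, e, f] :: ('a::zero)^6) $ 5 = e"
  "(vector [a, b, c, d, e, f] :: ('a::zero)^6) $ 6 = f"
  unfolding vector_def by simp_all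

lemmas mat6_simps = vec_eq_iff forall_6 matrix_matrix_mult_def sum_6 vector_6
  transpose_def mat_def

section \<open>The logarithms of the monodromy matrices\<close>

lemma unipotent_log_nilpotent4:
  fixes T :: mat6
  assumes "T - mat 1 = A" "A ** A = B" "A ** B = C" "A ** C = 0"
  shows "unipotent_log T = A - (1/2) *\<^sub>R B + (1/3) *\<^sub>R C"
proof -
  have range: "{1..<CARD(6)} = {1, 2, 3, 4, 5::nat}" by auto
  have pow: "matpow A 1 = A" "matpow A 2 = B" "matpow A 3 = C" "matpow A 4 = 0" "matpow A 5 = 0"
    using assms(2-4) by (simp_all add: eval_nat_numeral)
  show ?thesis
    unfolding unipotent_log_def assms(1) range
    by (simp add: pow[unfolded One_nat_def] del: matpow.simps)
qed

lemma N1_eq: "N1 = vector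
    [vector [0, -1, 0,   0, 1/2, 25/6],
     vector [0,  0, 0, -10,  -5,  1/2],
     vector [0,  0, 0, -10, -10,    0],
     vector [0,  0, 0,   0,   0,    0],
     vector [0,  0, 0,   0,   0,    1],
     vector [0,  0, 0,   0,   0,    0]]"
proof -
  let ?A = "vector
    [vector [ 0,  0,  0, 0,  0, 0],
     vector [ 1,  0,  0, 0,  0, 0],
     vector [ 0,  0,  0, 0,  0, 0],
     vector [ 5, 10, 10, 0,  0, 0],
     vector [ 2,  5, 10, 0,  0, 0],
     vector [-5, -3, -5, 0, -1, 0]] :: mat6"
  let ?B = "vector
    [vector [ 0,  0,   0, 0, 0, 0],
     vector [ 0,  0,   0, 0, 0, 0],
     vector [ 0,  0,   0, 0, 0, 0],
     vector [10,  0,   0, 0, 0, 0],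
     vector [ 5,  0,   0, 0, 0, 0],
     vector [-5, -5, -10, 0, 0, 0]] :: mat6"
  let ?C = "vector
    [vector [ 0, 0, 0, 0, 0, 0],
     vector [ 0, 0, 0, 0, 0, 0],
     vector [ 0, 0, 0, 0, 0, 0],
     vector [ 0, 0, 0, 0, 0, 0],
     vector [ 0, 0, 0, 0, 0, 0],
     vector [-5, 0, 0, 0, 0, 0]] :: mat6"
  have "unipotent_log Tx = ?A - (1/2) *\<^sub>R ?B + (1/3) *\<^sub>R ?C"
    by (rule unipotent_log_nilpotent4) (simp_all add: Tx_def mat6_simps)
  then show ?thesis
    unfolding N1_def by (simp add: mat6_simps)
qed

lemma N2_eq: "N2 = vector
    [vector [0, 0, -1, 1/2,   0, 25/6],
     vector [0, 0,  0, -10, -10,    0],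
     vector [0, 0,  0,  -5, -10,  1/2],
     vector [0, 0,  0,   0,   0,    1],
     vector [0, 0,  0,   0,   0,    0],
     vector [0, 0,  0,   0,   0,    0]]"
proof -
  let ?A = "vector
    [vector [ 0,  0,  0,  0, 0, 0],
     vector [ 0,  0,  0,  0, 0, 0],
     vector [ 1,  0,  0,  0, 0, 0],
     vector [ 2, 10,  5,  0, 0, 0],
     vector [ 5, 10, 10,  0, 0, 0],
     vector [-5, -5, -3, -1, 0, 0]] :: mat6"
  let ?B = "vector
    [vector [ 0,   0,  0, 0, 0, 0],
     vector [ 0,   0,  0, 0, 0, 0],
     vector [ 0,   0,  0, 0, 0, 0],
     vector [ 5,   0,  0, 0, 0, 0],
     vector [10,   0,  0, 0, 0, 0],
     vector [-5, -10, -5, 0, 0, 0]] :: mat6"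
  let ?C = "vector
    [vector [ 0, 0, 0, 0, 0, 0],
     vector [ 0, 0, 0, 0, 0, 0],
     vector [ 0, 0, 0, 0, 0, 0],
     vector [ 0, 0, 0, 0, 0, 0],
     vector [ 0, 0, 0, 0, 0, 0],
     vector [-5, 0, 0, 0, 0, 0]] :: mat6"
  have "unipotent_log Ty = ?A - (1/2) *\<^sub>R ?B + (1/3) *\<^sub>R ?C"
    by (rule unipotent_log_nilpotent4) (simp_all add: Ty_def mat6_simps)
  then show ?thesis
    unfolding N2_def by (simp add: mat6_simps)
qed

section \<open>Conjugation by the connection matrix\<close>

lemma conjugate_eqI:
  fixes P N M :: "real ^ 'n ^ 'n"
  assumes "invertible P" and "N ** P = P ** M"
  shows "matrix_inv P ** N ** P = M"
proof -
  have "matrix_inv P ** P = mat 1"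
    using someI_ex[OF assms(1)[unfolded invertible_def]] by (simp add: matrix_inv_def)
  then show ?thesis
    by (metis assms(2) matrix_mul_assoc matrix_mul_lid)
qed

lemma invertible_phi21: "invertible phi21"
  unfolding invertible_right_inverse
proof
  show "phi21 ** vector
    [vector [-1, 0,  0,  0,   0,  0],
     vector [ 0, 1, -4,  2, -25,  0],
     vector [ 0, 0, -1,  0,  -2,  0],
     vector [ 0, 0,  0, -1,  -4,  0],
     vector [ 0, 0,  0,  0,   1,  0],
     vector [ 0, 0,  0,  0,   0, -1]] = mat 1"
    unfolding phi21_def by (simp add: mat6_simps)
qed

lemma N2'_eq: "N2' = N2"
  unfolding N2'_def
  by (rule conjugate_eqI[OF invertible_phi21]) (simp add: N2_eq phi21_def mat6_simps)

definition Delta :: mat6 where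
  "Delta = vector
    [vector [0, 0, 0, 0,  25, -25/3],
     vector [0, 0, 0, 0, -50,    25],
     vector [0, 0, 0, 0,   0,     0],
     vector [0, 0, 0, 0,   0,     0],
     vector [0, 0, 0, 0,   0,     0],
     vector [0, 0, 0, 0,   0,     0]]"

lemma N1'_eq: "N1' = 4 *\<^sub>R N2 - N1 + Delta"
  unfolding N1'_def
  by (rule conjugate_eqI[OF invertible_phi21])
    (simp add: N1_eq N2_eq Delta_def phi21_def mat6_simps)

lemma Delta_nonzero: "Delta \<noteq> 0"
  by (simp add: Delta_def mat6_simps)

lemma Delta_annihilates_W2:
  assumes "w \<in> W2"
  shows "Delta *v w = 0"
proof (rule real_vector.span_induct[OF assms[unfolded W2_def]])
  show "subspace {w. Delta *v w = 0}"
    by (auto simp: subspace_def matrix_vector_right_distrib matrix_vector_mult_scaleR)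
qed (auto simp: Delta_def matrix_vector_mult_def axis_def mat6_simps)

text \<open>
  The map \<open>N1\<close> sends \<open>\<alpha>\<^sub>1\<close> to \<open>- \<alpha>\<^sub>0\<close> and \<open>\<alpha>\<^sub>2\<close> to \<open>0\<close>, while \<open>N2\<close> sends \<open>\<alpha>\<^sub>1\<close> to \<open>0\<close> and
  \<open>\<alpha>\<^sub>2\<close> to \<open>- \<alpha>\<^sub>0\<close>.  So the two entries in the row of \<open>\<alpha>\<^sub>0\<close> and the columns of \<open>\<alpha>\<^sub>1\<close>, \<open>\<alpha>\<^sub>2\<close> read
  off the coefficients of \<open>N1\<close> and \<open>N2\<close>, and these entries do not see \<open>\<Delta>\<close>.
\<close>

lemma N1_N2_N1'_independent:
  assumes "a *\<^sub>R N1 + b *\<^sub>R N2 + c *\<^sub>R N1' = 0"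
  shows "a = 0 \<and> b = 0 \<and> c = 0"
proof -
  have rel: "(a - c) *\<^sub>R N1 + (b + 4 * c) *\<^sub>R N2 + c *\<^sub>R Delta = 0"
    using assms unfolding N1'_eq by (simp add: algebra_simps)
  then have entry: "((a - c) *\<^sub>R N1 + (b + 4 * c) *\<^sub>R N2 + c *\<^sub>R Delta) $ 1 $ j = 0" for j
    by simp
  have "a - c = 0" "b + 4 * c = 0"
    using entry[of 2] entry[of 3] by (simp_all add: N1_eq N2_eq Delta_def vector_6)
  moreover from this have "c = 0"
    using rel Delta_nonzero by simp
  ultimately show ?thesis by simp
qed

section \<open>Cones over two independent vectors\<close>

definition cone_map :: "'a::real_vector \<Rightarrow> 'a \<Rightarrow> real \<times> real \<Rightarrow> 'a" where
  "cone_map X Y p = fst p *\<^sub>R X + snd p *\<^sub>R Y"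

lemma linear_cone_map: "linear (cone_map X Y)"
  by (rule linearI) (simp_all add: cone_map_def algebra_simps)

text \<open>
  Independence of three vectors is expressed by coefficients because the set \<open>{X, Y, Z}\<close> can be
  independent in degenerate cases such as \<open>X = Y\<close>.
\<close>

lemma inj_cone_maps_if_independent:
  assumes indep: "\<forall>a b c. a *\<^sub>R X + b *\<^sub>R Y + c *\<^sub>R Z = 0 \<longrightarrow> a = 0 \<and> b = 0 \<and> c = 0"
  shows "inj (cone_map X Y)" and "inj (cone_map Z Y)"
proof -
  have XY: "a = 0 \<and> b = 0" if "a *\<^sub>R X + b *\<^sub>R Y = 0" for a b
    using indep[rule_format, of a b 0] that by simp
  have ZY: "a = 0 \<and> b = 0" if "a *\<^sub>R Z + b *\<^sub>R Y = 0" for a b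
    using indep[rule_format, of 0 b a] that by (simp add: add.commute)
  show "inj (cone_map X Y)" "inj (cone_map Z Y)"
    unfolding linear_injective_0[OF linear_cone_map]
    using XY ZY by (auto simp: cone_map_def prod_eq_iff)
qed

lemma open_cone_eq_image: "open_cone X Y = cone_map X Y ` ({0<..} \<times> {0<..})"
  by (force simp: open_cone_def cone_map_def)

text \<open>
  Linear maps commute with closure only up to inclusion in general; injectivity makes the image of
  the closed quadrant closed.
\<close>

lemma closure_open_cone:
  fixes X Y :: "'a::euclidean_space"
  assumes inj: "inj (cone_map X Y)"
  shows "closure (open_cone X Y) = cone_map X Y ` ({0..} \<times> {0..})"
  unfolding open_cone_eq_image
    closure_injective_linear_image[OF linear_cone_map inj, symmetric]
  by (simp add: closure_Times)

lemma rel_frontier_open_cone: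
  fixes X Y :: "'a::euclidean_space"
  assumes inj: "inj (cone_map X Y)"
  shows "rel_frontier (open_cone X Y) =
    cone_map X Y ` ({0..} \<times> {0..} - {0<..} \<times> {0<..})"
proof -
  have "rel_interior (open_cone X Y) = cone_map X Y ` rel_interior ({0<..} \<times> {0<..})"
    unfolding open_cone_eq_image
    by (rule rel_interior_injective_linear_image[OF _ inj])
      (simp add: linear_conv_bounded_linear[symmetric] linear_cone_map)
  also have "rel_interior ({0<..} \<times> {0<..}) = ({0<..} \<times> {0<..} :: (real \<times> real) set)"
    by (intro rel_interior_open open_Times open_greaterThan)
  finally show ?thesis
    unfolding rel_frontier_def closure_open_cone[OF inj] by (simp only: image_set_diff[OF inj])
qed

lemma closed_ray_subset_rel_frontier:
  fixes X Y :: "'a::euclidean_space"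
  assumes inj: "inj (cone_map X Y)"
  shows "closed_ray Y \<subseteq> rel_frontier (open_cone X Y)"
proof
  fix v assume "v \<in> closed_ray Y"
  then obtain b where "v = cone_map X Y (0, b)" "b \<ge> 0"
    by (auto simp: closed_ray_def cone_map_def)
  then show "v \<in> rel_frontier (open_cone X Y)"
    unfolding rel_frontier_open_cone[OF inj] by simp
qed

text \<open>
  If a vector is written both by \<open>Z, Y\<close> and by \<open>X, Y\<close>, the difference of the two expressions is
  a relation in which \<open>X\<close> keeps its coefficient, so this coefficient is zero and only the
  \<open>Y\<close> part remains.
\<close>

lemma closures_of_cones_meet_in_ray:
  fixes X Y Z :: "'a::euclidean_space"
  assumes indep: "\<forall>a b c. a *\<^sub>R X + b *\<^sub>R Y + c *\<^sub>R Z = 0 \<longrightarrow> a = 0 \<and> b = 0 \<and> c = 0"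
  shows "closure (open_cone Z Y) \<inter> closure (open_cone X Y) = closed_ray Y"
proof -
  note XY = inj_cone_maps_if_independent(1)[OF indep]
    and ZY = inj_cone_maps_if_independent(2)[OF indep]
  have ray: "a *\<^sub>R X + b *\<^sub>R Y \<in> closed_ray Y"
    if eq: "c *\<^sub>R Z + d *\<^sub>R Y = a *\<^sub>R X + b *\<^sub>R Y" and "b \<ge> 0" for a b c d
  proof -
    have "a *\<^sub>R X + (b - d) *\<^sub>R Y + (- c) *\<^sub>R Z = 0"
      using eq by (simp add: algebra_simps)
    with indep have "a = 0" by blast
    with \<open>b \<ge> 0\<close> show ?thesis by (auto simp: closed_ray_def)
  qed
  have "closure (open_cone Z Y) \<inter> closure (open_cone X Y) \<subseteq> closed_ray Y"
    unfolding closure_open_cone[OF XY] closure_open_cone[OF ZY]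
    by (auto simp: cone_map_def intro: ray)
  moreover have "b *\<^sub>R Y \<in> cone_map U Y ` ({0..} \<times> {0..})" if "b \<ge> 0" for b U
    using that by (intro image_eqI[of _ _ "(0, b)"]) (simp_all add: cone_map_def)
  then have "closed_ray Y \<subseteq> closure (open_cone Z Y) \<inter> closure (open_cone X Y)"
    unfolding closure_open_cone[OF XY] closure_open_cone[OF ZY]
    by (auto simp: closed_ray_def)
  ultimately show ?thesis by blast
qed

text \<open>
  The apex and the generators do not belong to the open cones.  They lie in every affine set that
  contains these cones because affine sets are closed; the apex makes such a set a linear subspace.
\<close>

lemma aff_dim_containing_cones_ge_3:
  fixes X Y Z :: "'a::euclidean_space"
  assumes indep: "\<forall>a b c. a *\<^sub>R X + b *\<^sub>R Y + c *\<^sub>R Z = 0 \<longrightarrow> a = 0 \<and> b = 0 \<and> c = 0"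
    and P: "affine P" "open_cone X Y \<subseteq> P" "open_cone Z Y \<subseteq> P"
  shows "aff_dim P \<ge> 3"
proof -
  note XY = inj_cone_maps_if_independent(1)[OF indep]
    and ZY = inj_cone_maps_if_independent(2)[OF indep]
  have "closure (open_cone X Y) \<subseteq> P" "closure (open_cone Z Y) \<subseteq> P"
    using P by (simp_all add: closure_minimal affine_closed)
  then have mem: "a *\<^sub>R X + b *\<^sub>R Y \<in> P" "a *\<^sub>R Z + b *\<^sub>R Y \<in> P" if "a \<ge> 0" "b \<ge> 0" for a b
    using that unfolding closure_open_cone[OF XY] closure_open_cone[OF ZY]
    by (simp_all add: cone_map_def image_subset_iff)
  have "0 \<in> P" "{X, Y, Z} \<subseteq> P"
    using mem(1)[of 0 0] mem(1)[of 1 0] mem(1)[of 0 1] mem(2)[of 1 0] by auto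
  have distinct: "X \<noteq> Y" "X \<noteq> Z" "Y \<noteq> Z"
    using indep[rule_format, of 1 "-1" 0] indep[rule_format, of 1 0 "-1"]
      indep[rule_format, of 0 1 "-1"] by auto
  have "independent {X, Y, Z}"
  proof -
    have "u X = 0 \<and> u Y = 0 \<and> u Z = 0" if "(\<Sum>v\<in>{X, Y, Z}. u v *\<^sub>R v) = 0" for u
      using that distinct by (intro indep[rule_format]) (simp add: add.assoc)
    then show ?thesis
      by (subst real_vector.dependent_finite) auto
  qed
  then have "card {X, Y, Z} \<le> dim P"
    using \<open>{X, Y, Z} \<subseteq> P\<close> by (intro independent_card_le_dim)
  moreover have "aff_dim P = int (dim P)"
    using P(1) \<open>0 \<in> P\<close> by (simp add: aff_dim_subspace subspace_affine)
  ultimately show ?thesis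
    using distinct by simp
qed

section \<open>Gluing of the two monodromy cones\<close>

theorem proposition4p9:
  shows "(\<exists>\<Delta> :: real ^ 6 ^ 6.
            N1' = 4 *\<^sub>R N2 - N1 + \<Delta> \<and> \<Delta> \<noteq> 0 \<and> (\<forall>w \<in> W2. \<Delta> *v w = 0))
       \<and> N2' = N2
       \<and> closure Sigma_o2 \<inter> closure Sigma_o1 = closed_ray N2'
       \<and> closed_ray N2' = closed_ray N2
       \<and> closed_ray N2' \<subseteq> rel_frontier Sigma_o2
       \<and> closed_ray N2 \<subseteq> rel_frontier Sigma_o1
       \<and> (\<nexists>P :: (real ^ 6 ^ 6) set.
            affine P \<and> aff_dim P = 2 \<and> Sigma_o1 \<subseteq> P \<and> Sigma_o2 \<subseteq> P)"
proof (intro conjI)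
  show "\<exists>\<Delta>. N1' = 4 *\<^sub>R N2 - N1 + \<Delta> \<and> \<Delta> \<noteq> 0 \<and> (\<forall>w \<in> W2. \<Delta> *v w = 0)"
    using N1'_eq Delta_nonzero Delta_annihilates_W2 by blast
  show "N2' = N2" by (rule N2'_eq)
  show "closed_ray N2' = closed_ray N2" by (simp add: N2'_eq)
  have indep: "\<forall>a b c. a *\<^sub>R N1 + b *\<^sub>R N2 + c *\<^sub>R N1' = 0 \<longrightarrow> a = 0 \<and> b = 0 \<and> c = 0"
    using N1_N2_N1'_independent by blast
  show "closure Sigma_o2 \<inter> closure Sigma_o1 = closed_ray N2'"
    unfolding Sigma_o1_def Sigma_o2_def N2'_eq
    by (rule closures_of_cones_meet_in_ray[OF indep])
  show "closed_ray N2' \<subseteq> rel_frontier Sigma_o2"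
    unfolding Sigma_o2_def N2'_eq
    by (rule closed_ray_subset_rel_frontier[OF inj_cone_maps_if_independent(2)[OF indep]])
  show "closed_ray N2 \<subseteq> rel_frontier Sigma_o1"
    unfolding Sigma_o1_def
    by (rule closed_ray_subset_rel_frontier[OF inj_cone_maps_if_independent(1)[OF indep]])
  show "\<nexists>P. affine P \<and> aff_dim P = 2 \<and> Sigma_o1 \<subseteq> P \<and> Sigma_o2 \<subseteq> P"
    unfolding Sigma_o1_def Sigma_o2_def N2'_eq
    using aff_dim_containing_cones_ge_3[OF indep] by fastforce
qed

end
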